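(* Let $n\ge1$. The class $\mathcal{LC}_n$ is closed under additive convolution: if $f,g\in\mathcal{LC}_n$, then $f\boxplus g\in\mathcal{LC}_n$.
   Context: $[n]=\{1,\dots,n\}$. The squarefree algebra $\mathcal{A}_n:=\mathbb{R}[t_1,\dots,t_n]/(t_1^2,\dots,t_n^2)$ has basis $\{t^S: S\subseteq[n]\}$ with $t^S:=\prod_{i\in S}t_i$, $t^\varnothing=1$; write $f=\sum_{S\subseteq[n]}f_S t^S$ with $f_S\in\mathbb{R}$. Additive convolution: $(f\boxplus g)_S:=\sum_{A\subseteq S}f_A\,g_{S\setminus A}$ for all $S\subseteq[n]$. For $f\in\mathcal{A}_n$ with $f_\varnothing=1$, define $\log f:=\sum_{k=1}^n\frac{(-1)^{k+1}}{k}(f-1)^k=\sum_{\varnothing\ne S\subseteq[n]}\kappa_S(f)\,t^S$; the coefficients $\kappa_S(f)$ are the squarefree cumulants of $f$. $\mathcal{LC}_n$ (multilinearly log-concave polynomials) is the set of $f\in\mathcal{A}_n$ with $f_S\ge0$ for all $S\subseteq[n]$, $f_\varnothing=1$, and $\kappa_S(f)\le0$ for all $S\subseteq[n]$ with $|S|\ge2$. *)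

theory Defs
  imports Complex_Main "HOL-Library.Poly_Mapping" "HOL-Library.Cardinality"
begin

text \<open>
  The index set \<open>[n]\<close> is the universe of a finite type \<open>'n\<close>, so that \<open>n = CARD('n) \<ge> 1\<close> and
  subsets \<open>S\<close> of \<open>[n]\<close> have type \<open>'n set\<close>. Real polynomials in the variables \<open>t\<^sub>i\<close> are finitely
  supported maps from exponent vectors \<open>'n \<Rightarrow>\<^sub>0 nat\<close> to coefficients; Poly_Mapping makes them a
  commutative ring with the convolution product.
\<close>

type_synonym 'n rpoly = "('n \<Rightarrow>\<^sub>0 nat) \<Rightarrow>\<^sub>0 real"

definition rvar :: "'n \<Rightarrow> 'n rpoly" where
  "rvar i = Poly_Mapping.single (Poly_Mapping.single i 1) 1"

text \<open>The ideal generated by a set is its span in the ring regarded as a module over itself.\<close>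

definition square_ideal :: "'n rpoly set" where
  "square_ideal = module.span (*) (range (\<lambda>i. rvar i ^ 2))"

lemma module_mult: "module ((*) :: 'a::comm_ring_1 \<Rightarrow> 'a \<Rightarrow> 'a)"
  by unfold_locales (simp_all add: algebra_simps)

lemma square_ideal_zero: "0 \<in> square_ideal"
  unfolding square_ideal_def by (rule module.span_zero[OF module_mult])

lemma square_ideal_base: "rvar i ^ 2 \<in> square_ideal"
  unfolding square_ideal_def by (rule module.span_base[OF module_mult]) simp

lemma square_ideal_add: "p \<in> square_ideal \<Longrightarrow> q \<in> square_ideal \<Longrightarrow> p + q \<in> square_ideal"
  unfolding square_ideal_def by (rule module.span_add[OF module_mult])

lemma square_ideal_diff: "p \<in> square_ideal \<Longrightarrow> q \<in> square_ideal \<Longrightarrow> p - q \<in> square_ideal"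
  unfolding square_ideal_def by (rule module.span_diff[OF module_mult])

lemma square_ideal_uminus: "p \<in> square_ideal \<Longrightarrow> - p \<in> square_ideal"
  unfolding square_ideal_def by (rule module.span_neg[OF module_mult])

lemma square_ideal_mult: "p \<in> square_ideal \<Longrightarrow> q * p \<in> square_ideal"
  unfolding square_ideal_def by (rule module.span_scale[OF module_mult])

definition square_cong :: "'n rpoly \<Rightarrow> 'n rpoly \<Rightarrow> bool" where
  "square_cong p q \<longleftrightarrow> p - q \<in> square_ideal"

lemma equivp_square_cong: "equivp (square_cong :: 'a rpoly \<Rightarrow> _)"
proof (rule equivpI)
  show "reflp (square_cong :: 'a rpoly \<Rightarrow> _)"
    by (simp add: reflp_def square_cong_def square_ideal_zero)
  show "symp (square_cong :: 'a rpoly \<Rightarrow> _)"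
  proof (rule sympI)
    fix p q :: "'a rpoly"
    assume "square_cong p q"
    then show "square_cong q p"
      using square_ideal_uminus[of "p - q"] by (simp add: square_cong_def)
  qed
  show "transp (square_cong :: 'a rpoly \<Rightarrow> _)"
  proof (rule transpI)
    fix p q r :: "'a rpoly"
    assume "square_cong p q" "square_cong q r"
    then show "square_cong p r"
      using square_ideal_add[of "p - q" "q - r"] by (simp add: square_cong_def)
  qed
qed

lemma rvar_squared: "rvar i ^ 2 = Poly_Mapping.single (Poly_Mapping.single i 2) 1"
  unfolding rvar_def power2_eq_square by (simp add: mult_single numeral_2_eq_2 flip: single_add)

lemma square_ideal_coeff:
  assumes "p \<in> square_ideal" and k: "\<And>i. Poly_Mapping.lookup k i \<le> 1"
  shows "Poly_Mapping.lookup p k = 0"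
  using assms(1) unfolding square_ideal_def
proof (induction rule: module.span_induct_alt[OF module_mult, consumes 1, case_names base step])
  case base
  show ?case by simp
next
  case (step c x y)
  then obtain i where x: "x = rvar i ^ 2" by auto
  have x': "x = Poly_Mapping.single (Poly_Mapping.single i 2) 1"
    unfolding x by (rule rvar_squared)
  have "k \<noteq> l + Poly_Mapping.single i 2" for l
  proof
    assume "k = l + Poly_Mapping.single i 2"
    then have "Poly_Mapping.lookup k i = Poly_Mapping.lookup l i + 2"
      by (simp add: lookup_add)
    with k[of i] show False by simp
  qed
  then have "(Poly_Mapping.lookup x q when k = l + q) = 0" for l q
    by (auto simp: x' lookup_single when_def)
  then have "Poly_Mapping.lookup (c * x) k = 0"
    by (simp add: lookup_mult)
  with step show ?case by (simp add: lookup_add)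
qed

quotient_type 'n sqfree_alg = "'n rpoly" / square_cong
  by (rule equivp_square_cong)

instantiation sqfree_alg :: (type) comm_ring_1
begin

lift_definition zero_sqfree_alg :: "'a sqfree_alg" is 0 .

lift_definition one_sqfree_alg :: "'a sqfree_alg" is 1 .

lift_definition plus_sqfree_alg :: "'a sqfree_alg \<Rightarrow> 'a sqfree_alg \<Rightarrow> 'a sqfree_alg" is "(+)"
proof -
  fix p p' q q' :: "'a rpoly"
  assume "square_cong p p'" "square_cong q q'"
  then show "square_cong (p + q) (p' + q')"
    using square_ideal_add[of "p - p'" "q - q'"] by (simp add: square_cong_def algebra_simps)
qed

lift_definition minus_sqfree_alg :: "'a sqfree_alg \<Rightarrow> 'a sqfree_alg \<Rightarrow> 'a sqfree_alg" is "(-)"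
proof -
  fix p p' q q' :: "'a rpoly"
  assume "square_cong p p'" "square_cong q q'"
  then show "square_cong (p - q) (p' - q')"
    using square_ideal_diff[of "p - p'" "q - q'"] by (simp add: square_cong_def algebra_simps)
qed

lift_definition uminus_sqfree_alg :: "'a sqfree_alg \<Rightarrow> 'a sqfree_alg" is uminus
proof -
  fix p p' :: "'a rpoly"
  assume "square_cong p p'"
  then show "square_cong (- p) (- p')"
    using square_ideal_uminus[of "p - p'"] by (simp add: square_cong_def)
qed

lift_definition times_sqfree_alg :: "'a sqfree_alg \<Rightarrow> 'a sqfree_alg \<Rightarrow> 'a sqfree_alg" is "(*)"
proof -
  fix p p' q q' :: "'a rpoly"
  assume "square_cong p p'" "square_cong q q'"
  then have "q * (p - p') + p' * (q - q') \<in> square_ideal"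
    by (simp add: square_cong_def square_ideal_add square_ideal_mult)
  then show "square_cong (p * q) (p' * q')"
    by (simp add: square_cong_def algebra_simps)
qed

instance
proof
  fix a b c :: "'a sqfree_alg"
  have cong: "square_cong p q" if "p = q" for p q :: "'a rpoly"
    using that by (simp add: square_cong_def square_ideal_zero)
  show "a + b + c = a + (b + c)" by transfer (simp add: cong algebra_simps)
  show "a + b = b + a" by transfer (simp add: cong algebra_simps)
  show "0 + a = a" by transfer (simp add: cong)
  show "- a + a = 0" by transfer (simp add: cong)
  show "a - b = a + - b" by transfer (simp add: cong)
  show "a * b * c = a * (b * c)" by transfer (simp add: cong algebra_simps)
  show "a * b = b * a" by transfer (simp add: cong algebra_simps)
  show "1 * a = a" by transfer (simp add: cong)
  show "(a + b) * c = a * c + b * c" by transfer (simp add: cong algebra_simps)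
  show "(0 :: 'a sqfree_alg) \<noteq> 1"
  proof (transfer, rule notI)
    assume "square_cong (0 :: 'a rpoly) 1"
    then have "Poly_Mapping.lookup (0 - 1 :: 'a rpoly) 0 = 0"
      unfolding square_cong_def by (rule square_ideal_coeff) simp
    then show False by (simp add: lookup_minus)
  qed
qed

end

instantiation sqfree_alg :: (type) real_algebra_1
begin

lift_definition scaleR_sqfree_alg :: "real \<Rightarrow> 'a sqfree_alg \<Rightarrow> 'a sqfree_alg"
  is "\<lambda>c p. Poly_Mapping.single 0 c * p"
proof -
  fix c :: real and p p' :: "'a rpoly"
  assume "square_cong p p'"
  then show "square_cong (Poly_Mapping.single 0 c * p) (Poly_Mapping.single 0 c * p')"
    using square_ideal_mult[of "p - p'" "Poly_Mapping.single 0 c"]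
    by (simp add: square_cong_def algebra_simps)
qed

instance
proof
  fix a b :: real and x y :: "'a sqfree_alg"
  have cong: "square_cong p q" if "p = q" for p q :: "'a rpoly"
    using that by (simp add: square_cong_def square_ideal_zero)
  show "a *\<^sub>R (x + y) = a *\<^sub>R x + a *\<^sub>R y"
    by transfer (rule cong, simp add: algebra_simps)
  show "(a + b) *\<^sub>R x = a *\<^sub>R x + b *\<^sub>R x"
    by transfer (rule cong, simp add: single_add algebra_simps)
  show "a *\<^sub>R b *\<^sub>R x = (a * b) *\<^sub>R x"
    by transfer (rule cong, simp add: mult_single flip: mult.assoc)
  show "1 *\<^sub>R x = x"
    by transfer (rule cong, simp)
  show "a *\<^sub>R x * y = a *\<^sub>R (x * y)"
    by transfer (rule cong, simp add: algebra_simps)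
  show "x * a *\<^sub>R y = a *\<^sub>R (x * y)"
    by transfer (rule cong, simp add: algebra_simps)
qed

end

lift_definition tvar :: "'n \<Rightarrow> 'n sqfree_alg" is rvar .

lemma tvar_squared: "tvar i ^ 2 = 0"
  unfolding power2_eq_square
  by transfer (use square_ideal_base in \<open>simp add: square_cong_def power2_eq_square\<close>)

definition tmon :: "'n::finite set \<Rightarrow> 'n sqfree_alg" where
  "tmon S = (\<Prod>i\<in>S. tvar i)"

text \<open>
  The coefficient \<open>f\<^sub>S\<close> is the coefficient of the exponent vector of \<open>t\<^sup>S\<close> in any representative.
  The lemmas \<open>tmon_expansion\<close> and \<open>sqcoeff_unique\<close> below show that these are the coordinates of
  \<open>f\<close> with respect to the basis of the monomials \<open>t\<^sup>S\<close>.
\<close>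

definition sqexp :: "'n::finite set \<Rightarrow> 'n \<Rightarrow>\<^sub>0 nat" where
  "sqexp S = (\<Sum>i\<in>S. Poly_Mapping.single i 1)"

lemma lookup_sqexp: "Poly_Mapping.lookup (sqexp S) i = (if i \<in> S then 1 else 0)"
  by (simp add: sqexp_def lookup_sum lookup_single when_def)

lemma sqexp_inject: "sqexp S = sqexp T \<longleftrightarrow> S = T"
proof
  assume "sqexp S = sqexp T"
  then have "(if i \<in> S then 1 else 0 :: nat) = (if i \<in> T then 1 else 0)" for i
    by (metis lookup_sqexp)
  then have "i \<in> S \<longleftrightarrow> i \<in> T" for i
    by (metis zero_neq_one)
  then show "S = T" by blast
qed simp

lift_definition sqcoeff :: "'n::finite sqfree_alg \<Rightarrow> 'n set \<Rightarrow> real"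
  is "\<lambda>p S. Poly_Mapping.lookup p (sqexp S)"
proof -
  fix p q :: "'n rpoly"
  assume pq: "square_cong p q"
  have "Poly_Mapping.lookup (p - q) (sqexp S) = 0" for S
    using pq unfolding square_cong_def by (rule square_ideal_coeff) (simp add: lookup_sqexp)
  then show "(\<lambda>S. Poly_Mapping.lookup p (sqexp S)) = (\<lambda>S. Poly_Mapping.lookup q (sqexp S))"
    by (simp add: lookup_minus fun_eq_iff)
qed

lemma sqcoeff_zero: "sqcoeff 0 S = 0"
  by transfer simp

lemma sqcoeff_add: "sqcoeff (f + g) S = sqcoeff f S + sqcoeff g S"
  by transfer (simp add: lookup_add)

lemma sqcoeff_scaleR: "sqcoeff (c *\<^sub>R f) S = c * sqcoeff f S"
  by transfer
    (simp flip: mult_map_scale_conv_mult, simp add: Poly_Mapping.map.rep_eq when_def)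

lemma sqcoeff_sum: "sqcoeff (\<Sum>x\<in>X. h x) S = (\<Sum>x\<in>X. sqcoeff (h x) S)"
  by (induction X rule: infinite_finite_induct) (simp_all add: sqcoeff_zero sqcoeff_add)

lemma tmon_abs: "tmon S = abs_sqfree_alg (Poly_Mapping.single (sqexp S) 1)"
proof -
  have "finite S" by simp
  then show ?thesis unfolding tmon_def sqexp_def
  proof (induction S rule: finite_induct)
    case empty
    then show ?case by (simp add: one_sqfree_alg_def)
  next
    case (insert i S)
    then show ?case
      by (simp add: tvar.abs_eq rvar_def times_sqfree_alg.abs_eq mult_single)
  qed
qed

lemma sqcoeff_tmon: "sqcoeff (tmon T) S = (if S = T then 1 else 0)"
  by (auto simp: tmon_abs sqcoeff.abs_eq lookup_single when_def sqexp_inject)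

lemma sqcoeff_unique:
  assumes "f = (\<Sum>S\<in>UNIV. c S *\<^sub>R tmon S)"
  shows "c = sqcoeff f"
  unfolding assms
  by (simp add: fun_eq_iff sqcoeff_sum sqcoeff_scaleR sqcoeff_tmon if_distrib cong: if_cong)

lemma tmon_expansion:
  fixes f :: "'n::finite sqfree_alg"
  shows "f = (\<Sum>S\<in>UNIV. sqcoeff f S *\<^sub>R tmon S)"
proof -
  let ?E = "\<lambda>f :: 'n sqfree_alg. \<Sum>S\<in>UNIV. sqcoeff f S *\<^sub>R tmon S"
  have E_add: "?E (a + b) = ?E a + ?E b" for a b
    by (simp add: sqcoeff_add scaleR_left_distrib sum.distrib)
  have E_zero: "?E 0 = 0"
    by (simp add: sqcoeff_zero)
  have E_scale: "?E (c *\<^sub>R a) = c *\<^sub>R ?E a" for c a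
    by (simp add: sqcoeff_scaleR scaleR_right.sum)
  have E_tmon: "?E (tmon T) = tmon T" for T
    by (simp add: sqcoeff_tmon if_distrib[of "\<lambda>c. c *\<^sub>R _"] cong: if_cong)
  have single: "?E (abs_sqfree_alg (Poly_Mapping.single k c))
      = abs_sqfree_alg (Poly_Mapping.single k c)" for k c
  proof (cases "\<forall>i. Poly_Mapping.lookup k i \<le> 1")
    case True
    have "k = sqexp {i. Poly_Mapping.lookup k i = 1}"
    proof (rule poly_mapping_eqI)
      fix i
      show "Poly_Mapping.lookup k i
          = Poly_Mapping.lookup (sqexp {i. Poly_Mapping.lookup k i = 1}) i"
        using True[rule_format, of i] by (auto simp: lookup_sqexp)
    qed
    then obtain T where k: "k = sqexp T" by blast
    have "abs_sqfree_alg (Poly_Mapping.single k c) = c *\<^sub>R tmon T"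
      by (simp add: tmon_abs scaleR_sqfree_alg.abs_eq mult_single k)
    then show ?thesis by (simp only: E_scale E_tmon)
  next
    case False
    then obtain i where "\<not> Poly_Mapping.lookup k i \<le> 1" by blast
    then have i: "Poly_Mapping.lookup k i \<ge> 2" by simp
    have "k = (k - Poly_Mapping.single i 2) + Poly_Mapping.single i 2"
      by (rule poly_mapping_eqI)
        (use i in \<open>auto simp: lookup_add lookup_minus lookup_single when_def\<close>)
    then have "Poly_Mapping.single k c
        = Poly_Mapping.single (k - Poly_Mapping.single i 2) c * rvar i ^ 2"
      by (simp add: rvar_squared mult_single)
    then have "Poly_Mapping.single k c \<in> square_ideal"
      using square_ideal_mult[OF square_ideal_base] by metis
    then have "abs_sqfree_alg (Poly_Mapping.single k c) = 0"
      by (simp add: zero_sqfree_alg_def sqfree_alg.abs_eq_iff square_cong_def)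
    then show ?thesis by (simp only: E_zero)
  qed
  obtain p where p: "f = abs_sqfree_alg p"
    by (metis Quotient_sqfree_alg Quotient_def)
  have decomp: "p = (\<Sum>k\<in>Poly_Mapping.keys p. Poly_Mapping.single k (Poly_Mapping.lookup p k))"
    by (rule poly_mapping_eqI)
      (auto simp: lookup_sum lookup_single when_def not_in_keys_iff_lookup_eq_zero)
  have "?E (abs_sqfree_alg (\<Sum>k\<in>K. Poly_Mapping.single k (h k)))
      = abs_sqfree_alg (\<Sum>k\<in>K. Poly_Mapping.single k (h k))" if "finite K" for K h
    using that
  proof (induction K rule: finite_induct)
    case empty
    then show ?case using E_zero by (simp add: zero_sqfree_alg_def)
  next
    case (insert k K)
    have "abs_sqfree_alg (\<Sum>k\<in>insert k K. Poly_Mapping.single k (h k))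
        = abs_sqfree_alg (Poly_Mapping.single k (h k))
          + abs_sqfree_alg (\<Sum>k\<in>K. Poly_Mapping.single k (h k))"
      using insert by (simp add: plus_sqfree_alg.abs_eq)
    then show ?case by (simp only: E_add single insert.IH)
  qed
  from this[OF finite_keys[of p], of "Poly_Mapping.lookup p"] show ?thesis
    unfolding decomp[symmetric] p by (rule sym)
qed

definition add_conv :: "'n::finite sqfree_alg \<Rightarrow> 'n sqfree_alg \<Rightarrow> 'n sqfree_alg"
    (infixl \<open>\<boxplus>\<close> 65) where
  "f \<boxplus> g = (\<Sum>S\<in>UNIV. (\<Sum>A\<in>Pow S. sqcoeff f A * sqcoeff g (S - A)) *\<^sub>R tmon S)"

lemma sqcoeff_add_conv:
  "sqcoeff (f \<boxplus> g) S = (\<Sum>A\<in>Pow S. sqcoeff f A * sqcoeff g (S - A))"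
  using fun_cong[OF sqcoeff_unique[OF add_conv_def], of f g S] by simp

text \<open>Meaningful only for \<open>f\<close> with constant term \<open>1\<close>; the same holds for the cumulants.\<close>

definition sqlog :: "'n::finite sqfree_alg \<Rightarrow> 'n sqfree_alg" where
  "sqlog f = (\<Sum>k=1..CARD('n). ((-1) ^ (k + 1) / real k) *\<^sub>R (f - 1) ^ k)"

definition cumulant :: "'n::finite set \<Rightarrow> 'n sqfree_alg \<Rightarrow> real" where
  "cumulant S f = sqcoeff (sqlog f) S"

definition LC :: "'n::finite sqfree_alg set" where
  "LC = {f. (\<forall>S. sqcoeff f S \<ge> 0) \<and> sqcoeff f {} = 1 \<and> (\<forall>S. card S \<ge> 2 \<longrightarrow> cumulant S f \<le> 0)}"

end

(* Additive convolution is multiplication in the squarefree algebra, so the theorem amounts to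
   log (f g) = log f + log g for f and g with constant term 1.  The Euler derivation
   D (t^S) = |S| t^S satisfies D (log f) f = D f.  Hence D (log (f g)) and D (log f) + D (log g)
   agree after multiplication by the unit f g, and D determines all coefficients with S nonempty. *)
theory Submission
  imports Defs
begin

lemma sqcoeff_eqI:
  assumes "\<And>S. sqcoeff f S = sqcoeff g S"
  shows "f = g"
proof -
  have "sqcoeff f = sqcoeff g" using assms by (simp add: fun_eq_iff)
  then show ?thesis by (metis tmon_expansion)
qed

lemma sqcoeff_diff: "sqcoeff (f - g) S = sqcoeff f S - sqcoeff g S"
  using sqcoeff_add[of "f - g" g S] by simp

lemma sqcoeff_one: "sqcoeff 1 S = (if S = {} then 1 else 0)"
  using sqcoeff_tmon[of "{}" S] by (simp add: tmon_def)

text \<open>A shared index \<open>i\<close> contributes the factor \<open>tvar i ^ 2\<close>, which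
  vanishes.\<close>

lemma tmon_mult: "tmon A * tmon B = (if A \<inter> B = {} then tmon (A \<union> B) else 0)"
proof (cases "A \<inter> B = {}")
  case True
  then show ?thesis by (simp add: tmon_def prod.union_disjoint)
next
  case False
  then obtain i where i: "i \<in> A" "i \<in> B" by blast
  have "tmon A = tvar i * tmon (A - {i})" "tmon B = tvar i * tmon (B - {i})"
    using i by (simp_all add: tmon_def prod.remove)
  then have "tmon A * tmon B = tvar i ^ 2 * (tmon (A - {i}) * tmon (B - {i}))"
    by (simp add: power2_eq_square mult_ac)
  with False show ?thesis by (simp add: tvar_squared)
qed

text \<open>After expanding both factors in the monomial basis, each \<open>A\<close> contained in
  \<open>S\<close> has exactly one partner \<open>B\<close> that contributes to the coefficient at
  \<open>S\<close>, namely \<open>S - A\<close>; any other \<open>A\<close> has none. The resulting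
  formula is the one that defines the additive convolution.\<close>

lemma sqcoeff_mult:
  "sqcoeff (f * g) S = (\<Sum>A\<in>Pow S. sqcoeff f A * sqcoeff g (S - A))"
proof -
  have "f * g = (\<Sum>A\<in>UNIV. sqcoeff f A *\<^sub>R tmon A) * (\<Sum>B\<in>UNIV. sqcoeff g B *\<^sub>R tmon B)"
    by (simp flip: tmon_expansion)
  then have "sqcoeff (f * g) S =
      (\<Sum>A\<in>UNIV. \<Sum>B\<in>UNIV. sqcoeff f A * (sqcoeff g B * sqcoeff (tmon A * tmon B) S))"
    by (simp only: sum_product sqcoeff_sum mult_scaleR_left mult_scaleR_right sqcoeff_scaleR)
      (simp add: mult_ac)
  also have "\<dots> = (\<Sum>A\<in>UNIV. if A \<subseteq> S then sqcoeff f A * sqcoeff g (S - A) else 0)"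
  proof (rule sum.cong[OF refl])
    fix A :: "'a set"
    have "sqcoeff (tmon A * tmon B) S = (if B = S - A \<and> A \<subseteq> S then 1 else 0)" for B
      by (auto simp: tmon_mult sqcoeff_tmon sqcoeff_zero)
    then show "(\<Sum>B\<in>UNIV. sqcoeff f A * (sqcoeff g B * sqcoeff (tmon A * tmon B) S))
        = (if A \<subseteq> S then sqcoeff f A * sqcoeff g (S - A) else 0)"
      by (simp only:) (simp add: if_distrib[of "(*) _"] cong: if_cong)
  qed
  also have "\<dots> = (\<Sum>A\<in>Pow S. sqcoeff f A * sqcoeff g (S - A))"
    by (simp add: sum.If_cases Pow_def)
  finally show ?thesis .
qed

lemma add_conv_eq_mult: "f \<boxplus> g = f * g"
  by (rule sqcoeff_eqI) (simp add: sqcoeff_add_conv sqcoeff_mult)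

text \<open>Without a constant term, each factor \<open>x\<close> uses up at least one index, so
  only monomials of degree at least \<open>k\<close> survive in \<open>x ^ k\<close>.\<close>

lemma sqcoeff_power_eq_0:
  assumes "sqcoeff x {} = 0" and "card S < k"
  shows "sqcoeff (x ^ k) S = 0"
  using assms(2)
proof (induction k arbitrary: S)
  case (Suc k)
  have "sqcoeff x A * sqcoeff (x ^ k) (S - A) = 0" if "A \<in> Pow S" for A
  proof (cases "A = {}")
    case False
    with that have "S - A \<subset> S" by blast
    then have "card (S - A) < card S" by (simp add: psubset_card_mono)
    with Suc show ?thesis by simp
  qed (simp add: assms(1))
  then have "(\<Sum>A\<in>Pow S. sqcoeff x A * sqcoeff (x ^ k) (S - A)) = 0"
    by (intro sum.neutral ballI)
  then show ?case by (simp add: sqcoeff_mult)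
qed simp

text \<open>No index set has more than \<open>CARD('n)\<close> elements, so the degree bound leaves
  no monomial at all.\<close>

lemma power_Suc_card_eq_0:
  fixes x :: "'n::finite sqfree_alg"
  assumes "sqcoeff x {} = 0"
  shows "x ^ Suc (CARD('n)) = 0"
proof (rule sqcoeff_eqI)
  fix S :: "'n set"
  have "card S < Suc (CARD('n))" by (simp add: card_mono less_Suc_eq_le)
  then show "sqcoeff (x ^ Suc (CARD('n))) S = sqcoeff 0 S"
    using sqcoeff_power_eq_0[OF assms] by (simp add: sqcoeff_zero del: power_Suc)
qed

text \<open>Cancellation without constructing an inverse: with \<open>z = 1 - h\<close> nilpotent,
  the hypothesis says that \<open>y\<close> is fixed by multiplication by \<open>z\<close>, hence by
  every power of \<open>z\<close>, one of which is zero.\<close>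

lemma mult_eq_0_if_const_1:
  fixes h y :: "'n::finite sqfree_alg"
  assumes "sqcoeff h {} = 1" and "h * y = 0"
  shows "y = 0"
proof -
  define z where "z = 1 - h"
  have z: "sqcoeff z {} = 0" by (simp add: z_def sqcoeff_diff sqcoeff_one assms(1))
  have zy: "z * y = y" using assms(2) by (simp add: z_def algebra_simps)
  have "z ^ k * y = y" for k
    by (induction k) (simp_all add: mult.assoc zy)
  then show ?thesis using power_Suc_card_eq_0[OF z] by (metis mult_zero_left)
qed

text \<open>This is the operator \<Sum> t_i d/dt_i, written in coordinates. Its kernel consists of
  the constants.\<close>

definition euler_deriv :: "'n::finite sqfree_alg \<Rightarrow> 'n sqfree_alg" where
  "euler_deriv f = (\<Sum>S\<in>UNIV. (real (card S) * sqcoeff f S) *\<^sub>R tmon S)"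

lemma sqcoeff_euler_deriv: "sqcoeff (euler_deriv f) S = real (card S) * sqcoeff f S"
  using fun_cong[OF sqcoeff_unique[OF euler_deriv_def], of S f] by simp

lemma euler_deriv_add: "euler_deriv (f + g) = euler_deriv f + euler_deriv g"
  by (rule sqcoeff_eqI) (simp add: sqcoeff_euler_deriv sqcoeff_add algebra_simps)

lemma euler_deriv_diff: "euler_deriv (f - g) = euler_deriv f - euler_deriv g"
  by (rule sqcoeff_eqI) (simp add: sqcoeff_euler_deriv sqcoeff_diff algebra_simps)

lemma euler_deriv_scaleR: "euler_deriv (c *\<^sub>R f) = c *\<^sub>R euler_deriv f"
  by (rule sqcoeff_eqI) (simp add: sqcoeff_euler_deriv sqcoeff_scaleR)

lemma euler_deriv_0: "euler_deriv 0 = 0"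
  by (rule sqcoeff_eqI) (simp add: sqcoeff_euler_deriv sqcoeff_zero)

lemma euler_deriv_1: "euler_deriv 1 = 0"
  by (rule sqcoeff_eqI) (simp add: sqcoeff_euler_deriv sqcoeff_zero sqcoeff_one)

lemma euler_deriv_sum: "euler_deriv (\<Sum>x\<in>X. h x) = (\<Sum>x\<in>X. euler_deriv (h x))"
  by (induction X rule: infinite_finite_induct) (simp_all add: euler_deriv_0 euler_deriv_add)

text \<open>Leibniz rule, term by term in the convolution: the weight \<open>card S\<close> splits
  as \<open>card A + card (S - A)\<close>.\<close>

lemma euler_deriv_mult: "euler_deriv (f * g) = euler_deriv f * g + f * euler_deriv g"
proof (rule sqcoeff_eqI)
  fix S
  have "real (card S) * (sqcoeff f A * sqcoeff g (S - A))
      = real (card A) * sqcoeff f A * sqcoeff g (S - A)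
        + sqcoeff f A * (real (card (S - A)) * sqcoeff g (S - A))" if "A \<in> Pow S" for A
  proof -
    have "card S = card A + card (S - A)"
      using that card_Un_disjoint[of A "S - A"] by (simp add: Un_absorb1)
    then show ?thesis by (simp add: algebra_simps)
  qed
  then show "sqcoeff (euler_deriv (f * g)) S = sqcoeff (euler_deriv f * g + f * euler_deriv g) S"
    by (simp add: sqcoeff_euler_deriv sqcoeff_add sqcoeff_mult sum_distrib_left
        flip: sum.distrib)
qed

lemma euler_deriv_power:
  "euler_deriv (x ^ Suc k) = real (Suc k) *\<^sub>R (x ^ k * euler_deriv x)"
proof (induction k)
  case (Suc k)
  have "euler_deriv (x ^ Suc (Suc k)) = euler_deriv x * x ^ Suc k + x * euler_deriv (x ^ Suc k)"
    by (simp only: power_Suc[of x "Suc k"] euler_deriv_mult)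
  also have "\<dots> = x ^ Suc k * euler_deriv x + real (Suc k) *\<^sub>R (x ^ Suc k * euler_deriv x)"
    by (simp only: Suc.IH) (simp add: mult_ac)
  also have "\<dots> = real (Suc (Suc k)) *\<^sub>R (x ^ Suc k * euler_deriv x)"
    by (simp only: of_nat_Suc[of "Suc k"] scaleR_left_distrib scaleR_one)
  finally show ?case .
qed simp

text \<open>Differentiating the truncated logarithm gives a finite geometric sum in
  \<open>- x\<close> times \<open>euler_deriv x\<close>, and multiplication by
  \<open>f = 1 - (- x)\<close> telescopes it. The remainder contains \<open>x ^ ?n\<close>, which
  can be nonzero on its own, as for the sum of all variables; only its product with
  \<open>euler_deriv x\<close> is sure to vanish.\<close>

lemma euler_deriv_sqlog:
  fixes f :: "'n::finite sqfree_alg"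
  assumes "sqcoeff f {} = 1"
  shows "euler_deriv (sqlog f) * f = euler_deriv f"
proof -
  let ?n = "CARD('n)"
  define x where "x = f - 1"
  have f: "f = 1 - (- x)" by (simp add: x_def)
  have x0: "sqcoeff x {} = 0" by (simp add: x_def sqcoeff_diff sqcoeff_one assms)
  have Dx: "euler_deriv x = euler_deriv f" by (simp add: x_def euler_deriv_diff euler_deriv_1)
  \<comment> \<open>apply the derivation to \<open>x ^ Suc n = 0\<close>\<close>
  have xn: "x ^ ?n * euler_deriv x = 0"
  proof -
    have "real (Suc ?n) *\<^sub>R (x ^ ?n * euler_deriv x) = 0"
      by (simp only: power_Suc_card_eq_0[OF x0] euler_deriv_0 flip: euler_deriv_power)
    then show ?thesis by simp
  qed
  have summand: "euler_deriv (((-1) ^ (Suc k + 1) / real (Suc k)) *\<^sub>R x ^ Suc k)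
      = (- x) ^ k * euler_deriv x" for k
  proof -
    have "euler_deriv (((-1) ^ (Suc k + 1) / real (Suc k)) *\<^sub>R x ^ Suc k)
        = ((-1) ^ (Suc k + 1) / real (Suc k) * real (Suc k)) *\<^sub>R (x ^ k * euler_deriv x)"
      by (simp only: euler_deriv_scaleR euler_deriv_power scaleR_scaleR)
    also have "(-1) ^ (Suc k + 1) / real (Suc k) * real (Suc k) = (-1) ^ k"
      by (simp del: of_nat_Suc)
    finally show ?thesis
      by (simp add: power_minus[of x] scaleR_conv_of_real mult_ac)
  qed
  have "euler_deriv (sqlog f) = (\<Sum>k<?n. (- x) ^ k) * euler_deriv x"
  proof -
    \<comment> \<open>The shift by one makes the powers left after differentiation run from 0 to
      \<open>?n - 1\<close>, as the geometric sum requires.\<close>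
    have "sqlog f = (\<Sum>k<?n. ((-1) ^ (Suc k + 1) / real (Suc k)) *\<^sub>R x ^ Suc k)"
      unfolding sqlog_def x_def by (rule sum.reindex_bij_witness[of _ Suc "\<lambda>k. k - 1"]) auto
    then show ?thesis by (simp only: euler_deriv_sum summand sum_distrib_right)
  qed
  then have "euler_deriv (sqlog f) * f = ((1 - (- x)) * (\<Sum>k<?n. (- x) ^ k)) * euler_deriv x"
    by (simp add: f mult_ac)
  also have "\<dots> = (1 - (- x) ^ ?n) * euler_deriv x"
    by (simp only: one_diff_power_eq)
  also have "\<dots> = euler_deriv x"
    using xn by (simp add: power_minus[of x] left_diff_distrib mult.assoc)
  finally show ?thesis by (simp add: Dx)
qed

text \<open>The quotient in D(log h) = D(h) / h is avoided by multiplying with \<open>f * g\<close>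
  and cancelling it at the end. The derivation cannot see constant terms, hence the restriction on
  \<open>S\<close>.\<close>

lemma cumulant_mult:
  assumes "sqcoeff f {} = 1" and "sqcoeff g {} = 1" and "S \<noteq> {}"
  shows "cumulant S (f * g) = cumulant S f + cumulant S g"
proof -
  let ?u = "sqlog (f * g) - (sqlog f + sqlog g)"
  have fg: "sqcoeff (f * g) {} = 1" by (simp add: sqcoeff_mult assms)
  have "(f * g) * euler_deriv ?u
      = euler_deriv (sqlog (f * g)) * (f * g)
        - ((euler_deriv (sqlog f) * f) * g + f * (euler_deriv (sqlog g) * g))"
    by (simp add: euler_deriv_diff euler_deriv_add algebra_simps)
  \<comment> \<open>With the logarithmic derivatives cleared, the subtracted bracket is the Leibniz
    expansion of \<open>euler_deriv (f * g)\<close>.\<close>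
  also have "\<dots> = 0"
    by (simp only: euler_deriv_sqlog[OF fg] euler_deriv_sqlog[OF assms(1)]
        euler_deriv_sqlog[OF assms(2)] euler_deriv_mult diff_self)
  finally have "euler_deriv ?u = 0"
    by (rule mult_eq_0_if_const_1[OF fg])
  then have "real (card S) * sqcoeff ?u S = 0"
    by (simp flip: sqcoeff_euler_deriv add: sqcoeff_zero)
  with assms(3) have "sqcoeff ?u S = 0" by simp
  then show ?thesis by (simp add: cumulant_def sqcoeff_diff sqcoeff_add)
qed

theorem mainTheorem2:
  fixes f g :: "'n::finite sqfree_alg"
  assumes "f \<in> LC" and "g \<in> LC"
  shows "f \<boxplus> g \<in> LC"
proof -
  have f: "sqcoeff f {} = 1" and g: "sqcoeff g {} = 1"
    using assms by (simp_all add: LC_def)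
  have "sqcoeff (f * g) S \<ge> 0" for S
    using assms by (simp add: LC_def sqcoeff_mult sum_nonneg)
  moreover have "sqcoeff (f * g) {} = 1"
    by (simp add: sqcoeff_mult f g)
  moreover have "cumulant S (f * g) \<le> 0" if "card S \<ge> 2" for S
  proof -
    \<comment> \<open>Additivity covers every \<open>S\<close> on which the sign condition is
      imposed, and a sum of two nonpositive cumulants is nonpositive.\<close>
    have "S \<noteq> {}" using that by auto
    then have "cumulant S (f * g) = cumulant S f + cumulant S g"
      by (rule cumulant_mult[OF f g])
    also have "\<dots> \<le> 0" using assms that by (simp add: LC_def add_nonpos_nonpos)
    finally show ?thesis .
  qed
  ultimately show ?thesis by (simp add: add_conv_eq_mult LC_def)
qed

end
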